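(* Let $s\in\mathbb C$ and $\delta>0$ be fixed. For each integer $m\ge2$ the function $\zeta_E^{(m)}(s,q)=\frac{\partial^m}{\partial s^m}\zeta_E(s,q)$ has the asymptotic expansion in terms of the derivatives of lower orders $$\begin{aligned}\zeta_E^{(m)}(s,q)&\sim-\left[\left(\frac{\partial}{\partial s}+\log q\right)^m-\left(\frac{\partial}{\partial s}\right)^m\right]\zeta_E(s,q)-\frac12\Sigma_m(s,q)\\&=-\sum_{j=1}^m\binom mj\zeta_E^{(m-j)}(s,q)\log^jq-\frac12\Sigma_m(s,q)\end{aligned}$$ as $|q|\to\infty$ in the sector $|\arg q|\le\pi-\delta$, where $$\Sigma_m(s,q)=\sum_{k=1}^\infty q^{-s-2k-1}c_k^m(s)$$ and $$c_k^m(s)=E_{2k+1}(0)\sum_{j_1=0}^{2k}\frac1{2k-j_1+1}\sum_{j_2=0}^{j_1-1}\frac1{j_1-j_2}\cdots\sum_{j_m=0}^{j_{m-1}-1}\frac{(s)_{j_m}}{j_m!\,(j_{m-1}-j_m)}.$$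
   Context: For $|\arg q|<\pi$, $\zeta_E(s,q)$ denotes the alternating Hurwitz zeta function, defined for $\mathrm{Re}(s)>0$ by $\zeta_E(s,q)=\sum_{n=0}^\infty \frac{(-1)^n}{(n+q)^s}$ (principal branches) and extended to an entire function of $s\in\mathbb C$ by analytic continuation; $\zeta_E^{(0)}=\zeta_E$. $E_n(x)$ are the Euler polynomials, $\frac{2e^{xt}}{e^t+1}=\sum_{n\ge0}E_n(x)\frac{t^n}{n!}$ for $|t|<\pi$. $(s)_k=s(s+1)\cdots(s+k-1)$, $(s)_0=1$. $\log^jq=(\log q)^j$; powers and $\log q$ are principal values. Empty sums are zero. $\Sigma_m(s,q)$ is a formal (asymptotic) series. The symbol $\sim$ means asymptotic expansion in the Poincaré sense: for each integer $K\ge0$, the difference between the left side and the right side with the series $\Sigma_m$ truncated after $k=K$ is $O(|q|^{-\mathrm{Re}(s)-2K-3})$ as $|q|\to\infty$ in the sector, the implied constant depending only on $s,m,\delta,K$. *)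

theory Defs
  imports
    "HOL-Complex_Analysis.Complex_Analysis"
    "HOL-Library.Landau_Symbols"
begin

text \<open>
  The alternating Hurwitz zeta function, as an entire function of \<open>s\<close>. It is meant for
  \<open>q \<noteq> 0\<close> with \<open>\<bar>Arg q\<bar> < pi\<close>; for other \<open>q\<close> nothing is claimed about the value. The analytic continuation
  is unique by the identity theorem.
\<close>

definition alt_hurwitz_zeta :: "complex \<Rightarrow> complex \<Rightarrow> complex" where
  "alt_hurwitz_zeta s q =
     (THE f. f holomorphic_on UNIV \<and>
        (\<forall>z. Re z > 0 \<longrightarrow> (\<lambda>n. (-1) ^ n / (of_nat n + q) powr z) sums f z)) s"

text \<open>
  The Euler polynomials \<open>E\<^sub>n(x)\<close>, through their exponential generating function
  \<open>2 exp(x t) / (exp t + 1)\<close> read as a formal power series in \<open>t\<close>.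
\<close>

definition euler_poly :: "nat \<Rightarrow> complex \<Rightarrow> complex" where
  "euler_poly n x = fact n * fps_nth (2 * fps_exp x / (fps_exp 1 + 1)) n"

lemma euler_poly_sums:
  assumes "norm t < pi"
  shows "(\<lambda>n. euler_poly n x * t ^ n / fact n) sums (2 * exp (x * t) / (exp t + 1))"
proof -
  define F :: "complex fps" where "F = 2 * fps_exp x / (fps_exp 1 + 1)"
  define f where "f = (\<lambda>t. 2 * exp (x * t) / (exp t + 1))"
  have nz: "exp t + 1 \<noteq> 0" if "norm t < pi" for t :: complex
  proof
    assume "exp t + 1 = 0"
    then have "exp t = exp (\<i> * of_real pi)"
      by (simp add: add_eq_0_iff2)
    then obtain n :: int where n: "t = \<i> * of_real pi + of_int (2 * n) * of_real pi * \<i>"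
      unfolding exp_eq by (auto simp: algebra_simps)
    have "Im t = pi * (1 + 2 * of_int n)"
      by (simp add: n algebra_simps)
    moreover have "\<bar>1 + 2 * of_int n :: real\<bar> \<ge> 1"
    proof -
      have "\<bar>1 + 2 * n\<bar> \<ge> 1" by presburger
      then have "real_of_int \<bar>1 + 2 * n\<bar> \<ge> 1" by linarith
      then show ?thesis by simp
    qed
    ultimately have "\<bar>Im t\<bar> \<ge> pi"
      by (simp add: abs_mult)
    then show False
      using abs_Im_le_cmod[of t] that by linarith
  qed
  have hol: "f holomorphic_on ball 0 pi"
    unfolding f_def by (intro holomorphic_intros) (auto simp: nz)
  have "f has_fps_expansion F"
    unfolding f_def F_def
    by (intro fps_expansion_intros) (auto simp: fps_eq_iff)
  then have coeff: "fps_nth F n = (deriv ^^ n) f 0 / fact n" for n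
    by (simp add: fps_nth_fps_expansion)
  have "(\<lambda>n. (deriv ^^ n) f 0 / fact n * (t - 0) ^ n) sums f t"
    by (rule holomorphic_power_series[OF hol]) (use assms in auto)
  then show ?thesis
    unfolding euler_poly_def F_def[symmetric] coeff by (simp add: f_def)
qed

text \<open>
  Iterated sum: \<open>nested_sum s m j\<^sub>0\<close> is the sum over \<open>j\<^sub>0 > j\<^sub>1 > \<dots> > j\<^sub>m \<ge> 0\<close> of
  \<open>(s)\<^bsub>j\<^sub>m\<^esub> / j\<^sub>m!\<close> divided by the product of the differences \<open>j\<^bsub>i-1\<^esub> - j\<^sub>i\<close>.
\<close>

primrec nested_sum :: "complex \<Rightarrow> nat \<Rightarrow> nat \<Rightarrow> complex" where
  "nested_sum s 0 j = pochhammer s j / fact j"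
| "nested_sum s (Suc m) j = (\<Sum>i<j. 1 / of_nat (j - i) * nested_sum s m i)"

text \<open>
  The outermost sum of \<open>c\<^sub>k\<^sup>m(s)\<close> runs over \<open>0 \<le> j\<^sub>1 \<le> 2k\<close> with denominator
  \<open>2k + 1 - j\<^sub>1\<close>, so it fits the pattern with \<open>j\<^sub>0 = 2k + 1\<close>.
\<close>

definition c_coeff :: "nat \<Rightarrow> nat \<Rightarrow> complex \<Rightarrow> complex" where
  "c_coeff m k s = euler_poly (2 * k + 1) 0 * nested_sum s m (2 * k + 1)"

definition Sigma_trunc :: "nat \<Rightarrow> nat \<Rightarrow> complex \<Rightarrow> complex \<Rightarrow> complex" where
  "Sigma_trunc m K s q =
     (\<Sum>k=1..K. q powr (- s - 2 * of_nat k - 1) * c_coeff m k s)"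

definition deriv_plus_log :: "complex \<Rightarrow> (complex \<Rightarrow> complex) \<Rightarrow> complex \<Rightarrow> complex" where
  "deriv_plus_log q f = (\<lambda>s. deriv f s + Ln q * f s)"

definition sector :: "real \<Rightarrow> complex set" where
  "sector \<delta> = {q. q \<noteq> 0 \<and> \<bar>Arg q\<bar> \<le> pi - \<delta>}"

end

theory Submission
  imports Defs
begin

text \<open>
  The generating function \<open>2 / (exp t + 1)\<close> gives polynomials
  \<open>b\<^sub>j(z) = (-1)\<^sup>j E\<^sub>j(0) / 2 \<cdot> (z)\<^sub>j / j!\<close> for which \<open>P(q) = q powr (-z) \<cdot> (\<Sum>j<N. b\<^sub>j(z) / q ^ j)\<close> solves
  the difference equation \<open>P(q) + P(q + 1) = q powr (-z)\<close> up to an error \<open>r(q)\<close> of order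
  \<open>q powr (-z - N)\<close>, uniformly for bounded \<open>z\<close>. Summing alternately over \<open>q, q + 1, \<dots>\<close> the series
  of the zeta function becomes \<open>P(q) - (\<Sum>n. (-1) ^ n * r(q + n))\<close>. The last sum converges as
  soon as \<open>Re z + N \<ge> 2\<close>, which yields the analytic continuation, and its size gives the expansion
  of \<open>q powr z \<cdot> \<zeta>\<^sub>E(z, q)\<close> in powers of \<open>1 / q\<close>, uniformly on compact sets of \<open>z\<close>, so that by
  Cauchy's inequality it may be differentiated \<open>m\<close> times in \<open>z\<close>. Differentiating
  \<open>q powr z \<cdot> f\<close> amounts to applying \<open>\<partial>/\<partial>z + log q\<close> to \<open>f\<close>, and the \<open>m\<close>-th
  derivative of \<open>(z)\<^sub>j / j!\<close> is the iterated sum in \<open>c\<^sub>k\<^sup>m\<close>, which vanishes for \<open>j < m\<close>.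
\<close>

subsection \<open>Euler polynomials at zero and derivatives of Pochhammer symbols\<close>

text \<open>The divisor has constant term 2, so it is a unit and the quotient of formal power series
  is a genuine one.\<close>

lemma euler_series_mult:
  "(2 * fps_exp 0 / (fps_exp 1 + 1)) * (fps_exp 1 + 1) = (2 :: complex fps)"
proof -
  have "fps_nth (fps_exp 1 + 1 :: complex fps) 0 \<noteq> 0"
    by simp
  then show ?thesis
    by (simp add: fps_divide_unit inverse_mult_eq_1 mult.assoc)
qed

text \<open>Compare the coefficients of \<open>t^n\<close> in \<open>F + F exp t = 2\<close>, with
  \<open>F = 2 / (exp t + 1)\<close>, and multiply by \<open>n!\<close>.\<close>

lemma euler_poly_0_recurrence:
  "euler_poly n 0 + (\<Sum>j\<le>n. of_nat (n choose j) * euler_poly j 0) = (if n = 0 then 2 else 0)"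
proof -
  define F :: "complex fps" where "F = 2 * fps_exp 0 / (fps_exp 1 + 1)"
  have "F + F * fps_exp 1 = 2"
    using euler_series_mult by (simp add: F_def algebra_simps)
  then have "fps_nth (F + F * fps_exp 1) n = fps_nth 2 n"
    by simp
  then have "fps_nth F n + (\<Sum>j=0..n. fps_nth F j / fact (n - j)) = fps_nth 2 n"
    by (simp add: fps_mult_nth)
  then have "fact n * (fps_nth F n + (\<Sum>j\<le>n. fps_nth F j / fact (n - j))) = (if n = 0 then 2 else 0)"
    by (simp add: atMost_atLeast0 fps_numeral_nth)
  moreover have "fact n * (\<Sum>j\<le>n. fps_nth F j / fact (n - j)) = (\<Sum>j\<le>n. of_nat (n choose j) * euler_poly j 0)"
    unfolding sum_distrib_left
    by (rule sum.cong) (auto simp: euler_poly_def F_def binomial_fact)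
  ultimately show ?thesis
    by (simp add: algebra_simps euler_poly_def F_def)
qed

text \<open>The series \<open>F(t) = 2 / (exp t + 1)\<close> satisfies
  \<open>F(t) + F(-t) = 2\<close>, so its even part is constant. In the proof \<open>G\<close>
  stands for \<open>F(-t)\<close>.\<close>

lemma euler_poly_0_even:
  assumes "even n" "n > 0"
  shows "euler_poly n 0 = 0"
proof -
  define F :: "complex fps" where "F = 2 * fps_exp 0 / (fps_exp 1 + 1)"
  define G where "G = Abs_fps (\<lambda>n. (-1) ^ n * fps_nth F n)"
  have F: "F * (fps_exp 1 + 1) = 2"
    using euler_series_mult by (simp add: F_def)
  have G: "G * (fps_exp (-1) + 1) = 2"
  proof (rule fps_ext)
    fix n
    have "fps_nth (G * (fps_exp (-1) + 1)) n = (-1) ^ n * fps_nth (F * (fps_exp 1 + 1)) n"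
      by (auto simp: G_def fps_mult_nth sum_distrib_left distrib_left fps_one_nth
          simp flip: power_add intro!: sum.cong)
    then show "fps_nth (G * (fps_exp (-1) + 1)) n = fps_nth 2 n"
      by (simp add: F fps_numeral_nth)
  qed
  have e: "fps_exp (-1) * fps_exp 1 = (1 :: complex fps)"
    by (simp flip: fps_exp_add_mult)
  \<comment> \<open>The factor \<open>exp t\<close> turns \<open>exp (-t) + 1\<close> into
    \<open>exp t + 1\<close>, which gives \<open>F\<close> and \<open>G\<close> a common
    denominator.\<close>
  have "G * (fps_exp 1 + 1) = G * (fps_exp (-1) + 1) * fps_exp 1"
    by (simp add: distrib_left distrib_right mult.assoc e add.commute)
  then have "G * (fps_exp 1 + 1) = 2 * fps_exp 1"
    unfolding G .
  then have "(F + G) * (fps_exp 1 + 1) = 2 * (fps_exp 1 + 1)"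
    unfolding distrib_right[of F G] F by simp
  moreover have "fps_nth (fps_exp 1 + 1 :: complex fps) 0 \<noteq> 0"
    by simp
  then have "(fps_exp 1 + 1 :: complex fps) \<noteq> 0"
    by (metis fps_zero_nth)
  ultimately have "F + G = 2"
    by (metis mult_right_cancel)
  then have "fps_nth F n + fps_nth G n = fps_nth 2 n"
    by (metis fps_add_nth)
  then show ?thesis
    using assms by (simp add: G_def fps_numeral_nth euler_poly_def F_def)
qed

lemma pochhammer_fact_recurrence:
  fixes z :: complex
  shows "of_nat (Suc n) * (pochhammer z (Suc n) / fact (Suc n)) = (z + of_nat n) * (pochhammer z n / fact n)"
  by (simp add: pochhammer_Suc field_simps del: of_nat_Suc)

text \<open>The generating function of \<open>(z)\<^sub>n / n!\<close> is \<open>(1 - x) powr (- z)\<close>, and differentiating it in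
  \<open>z\<close> multiplies it by \<open>- ln (1 - x)\<close>; this is the coefficient form of that fact.\<close>

lemma has_field_derivative_pochhammer_fact:
  "((\<lambda>z. pochhammer z n / fact n) has_field_derivative nested_sum z 1 n) (at z)"
proof (induction n)
  case 0
  then show ?case by simp
next
  case (Suc n)
  define u where "u = (\<lambda>i. pochhammer z i / fact i)"
  define v where "v = (\<lambda>n. nested_sum z 1 n)"
  have v: "v n = (\<Sum>i<n. u i / of_nat (n - i))" for n
    by (simp add: v_def u_def mult.commute)
  have u: "of_nat (Suc i) * u (Suc i) = (z + of_nat i) * u i" for i
    unfolding u_def by (rule pochhammer_fact_recurrence)
  \<comment> \<open>Write \<open>Suc n = (Suc n - i) + i\<close>; the first summand cancels the
    denominator.\<close>
  have "of_nat (Suc n) * v (Suc n) = (\<Sum>i<Suc n. u i + of_nat i * u i / of_nat (Suc n - i))"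
    unfolding v sum_distrib_left
  proof (rule sum.cong)
    fix i assume "i \<in> {..<Suc n}"
    then have "of_nat (Suc n - i) \<noteq> (0 :: complex)"
      "of_nat (Suc n) = (of_nat (Suc n - i) + of_nat i :: complex)"
      by (auto simp flip: of_nat_add simp del: of_nat_Suc)
    then show "of_nat (Suc n) * (u i / of_nat (Suc n - i)) = u i + of_nat i * u i / of_nat (Suc n - i)"
      by (simp add: field_simps del: of_nat_Suc)
  qed simp
  also have "\<dots> = (\<Sum>i<n. u i) + u n + (\<Sum>i<Suc n. of_nat i * u i / of_nat (Suc n - i))"
    by (simp add: sum.distrib)
  \<comment> \<open>The term \<open>i = 0\<close> vanishes, and after the index shift the recurrence
    \<open>u\<close> applies to each remaining term.\<close>
  also have "(\<Sum>i<Suc n. of_nat i * u i / of_nat (Suc n - i)) = (\<Sum>i<n. (z + of_nat i) * u i / of_nat (n - i))"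
    by (subst sum.lessThan_Suc_shift) (simp add: u del: of_nat_Suc)
  also have "\<dots> = (\<Sum>i<n. (z + of_nat n) * u i / of_nat (n - i) - u i)"
  proof (rule sum.cong)
    fix i assume "i \<in> {..<n}"
    then show "(z + of_nat i) * u i / of_nat (n - i) = (z + of_nat n) * u i / of_nat (n - i) - u i"
      by (simp add: field_simps of_nat_diff)
  qed simp
  also have "\<dots> = (z + of_nat n) * v n - (\<Sum>i<n. u i)"
    by (simp add: v sum_subtractf sum_distrib_left)
  \<comment> \<open>This is the recurrence \<open>u\<close> differentiated formally in
    \<open>z\<close>, with \<open>v\<close> in place of the derivative of \<open>u\<close>.\<close>
  finally have v_Suc: "of_nat (Suc n) * v (Suc n) = u n + (z + of_nat n) * v n"
    by simp
  have "((\<lambda>z. pochhammer z n / fact n) has_field_derivative v n) (at z)"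
    using Suc.IH by (simp add: v_def)
  moreover have "((\<lambda>z. z + of_nat n) has_field_derivative 1) (at z)"
    by (auto intro!: derivative_eq_intros)
  ultimately have "((\<lambda>z. (z + of_nat n) * (pochhammer z n / fact n)) has_field_derivative
      (z + of_nat n) * v n + 1 * u n) (at z)"
    unfolding u_def by (rule DERIV_mult'[rotated])
  then have "((\<lambda>z. (z + of_nat n) * (pochhammer z n / fact n) / of_nat (Suc n)) has_field_derivative
      (u n + (z + of_nat n) * v n) / of_nat (Suc n)) (at z)"
    by (intro DERIV_cdivide) (simp add: add.commute)
  moreover have "(\<lambda>z. (z + of_nat n) * (pochhammer z n / fact n) / of_nat (Suc n)) =
      (\<lambda>z. pochhammer z (Suc n) / fact (Suc n) :: complex)"
    by (simp add: pochhammer_Suc fun_eq_iff field_simps)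
  moreover have "(u n + (z + of_nat n) * v n) / of_nat (Suc n) = v (Suc n)"
    unfolding v_Suc[symmetric] by (simp del: of_nat_Suc)
  ultimately show ?case
    by (simp add: v_def)
qed

text \<open>The weights of the nested sum do not depend on \<open>z\<close>, so the derivative
  reaches the innermost factor \<open>(z)_j / j!\<close> and there opens one further level of
  summation.\<close>

lemma has_field_derivative_nested_sum:
  "((\<lambda>z. nested_sum z m n) has_field_derivative nested_sum z (Suc m) n) (at z)"
proof (induction m arbitrary: n)
  case 0
  then show ?case
    using has_field_derivative_pochhammer_fact[of n z] by simp
next
  case (Suc m)
  have "((\<lambda>z. \<Sum>i<n. 1 / of_nat (n - i) * nested_sum z m i) has_field_derivative
      (\<Sum>i<n. 1 / of_nat (n - i) * nested_sum z (Suc m) i)) (at z)"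
    by (intro DERIV_sum DERIV_cmult Suc.IH)
  then show ?case
    by simp
qed

text \<open>There is no chain \<open>n > j_1 > ... > j_m >= 0\<close> when
  \<open>n < m\<close>.\<close>

lemma nested_sum_eq_0: "n < m \<Longrightarrow> nested_sum z m n = 0"
  by (induction m arbitrary: n) auto

subsection \<open>An approximate solution of the difference equation\<close>

lemma add_one_neq_0:
  fixes q :: complex
  assumes "q \<notin> \<real>\<^sub>\<le>\<^sub>0"
  shows "q \<noteq> 0" "q + 1 \<noteq> 0" "1 + 1 / q \<noteq> 0"
proof -
  show q: "q \<noteq> 0"
    using assms by auto
  have "q \<noteq> - 1"
    using assms by auto
  then show "q + 1 \<noteq> 0"
    by (metis add_eq_0_iff2)
  then show "1 + 1 / q \<noteq> 0"
    using q by (simp add: field_simps)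
qed

text \<open>The imaginary parts of \<open>q\<close> and \<open>1 + 1 / q\<close> have opposite
  signs, hence so do the two arguments; their sum stays in the principal range and no multiple of
  \<open>2 pi\<close> appears.\<close>

lemma Ln_add_one:
  assumes "q \<notin> \<real>\<^sub>\<le>\<^sub>0"
  shows "Ln (q + 1) = Ln q + Ln (1 + 1 / q)"
proof -
  note q = add_one_neq_0[OF assms]
  have im: "Im (1 + 1 / q) = - Im q / (norm q)^2"
    by (simp add: Im_divide cmod_power2)
  have eq: "q + 1 = q * (1 + 1 / q)"
    using q by (simp add: field_simps)
  consider "Im q > 0" | "Im q < 0" | "Im q = 0" "Re q > 0"
    using assms by (fastforce simp: complex_nonpos_Reals_iff)
  then have "- pi < Im (Ln q) + Im (Ln (1 + 1 / q)) \<and> Im (Ln q) + Im (Ln (1 + 1 / q)) \<le> pi"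
  proof cases
    case 1
    then have "Im (1 + 1 / q) < 0"
      unfolding im using q by (simp add: divide_neg_pos)
    then have "Im (Ln (1 + 1 / q)) < 0"
      using Im_Ln_pos_le[OF q(3)] Im_Ln_le_pi[OF q(3)] by linarith
    then show ?thesis
      using Im_Ln_pos_lt_imp[OF 1] mpi_less_Im_Ln[OF q(3)] by linarith
  next
    case 2
    then have "Im (1 + 1 / q) > 0"
      unfolding im using q by (simp add: divide_neg_pos)
    then have "0 < Im (Ln (1 + 1 / q)) \<and> Im (Ln (1 + 1 / q)) < pi"
      by (rule Im_Ln_pos_lt_imp)
    moreover have "Im (Ln q) < 0"
      using 2 Im_Ln_pos_le[OF q(1)] Im_Ln_le_pi[OF q(1)] by linarith
    ultimately show ?thesis
      using mpi_less_Im_Ln[OF q(1)] by linarith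
  next
    case 3
    then have "Im (Ln q) = 0"
      by (simp add: Im_Ln_eq_0 q)
    then show ?thesis
      using mpi_less_Im_Ln[OF q(3)] Im_Ln_le_pi[OF q(3)] by simp
  qed
  then show ?thesis
    unfolding eq using q by (intro Ln_times_simple) auto
qed

section \<open>Remainder of the binomial series, uniformly in the exponent\<close>

lemma norm_gbinomial_le:
  fixes a :: "'a :: real_normed_field"
  assumes "norm a \<le> A"
  shows "norm (a gchoose k) \<le> pochhammer A k / fact k"
proof -
  have "norm (pochhammer (- a) k) \<le> pochhammer A k"
    unfolding pochhammer_prod prod_norm[symmetric]
  proof (rule prod_mono)
    fix i
    show "0 \<le> norm (- a + of_nat i) \<and> norm (- a + of_nat i) \<le> A + of_nat i"
      using norm_triangle_ineq[of "- a" "of_nat i"] assms by simp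
  qed
  then show ?thesis
    by (simp add: gbinomial_pochhammer norm_mult norm_divide norm_power divide_right_mono)
qed

text \<open>This is the binomial series of \<open>(1 - 1/2) powr (- A)\<close>.\<close>

lemma summable_pochhammer_half:
  fixes A :: real
  shows "summable (\<lambda>k. pochhammer A k / fact k * (1 / 2) ^ k)"
proof -
  have "(\<lambda>k. (- A gchoose k) * (- 1 / 2) ^ k) sums (1 + - 1 / 2) powr (- A)"
    by (rule gen_binomial_real) simp
  moreover have "(- A gchoose k) * (- 1 / 2) ^ k = pochhammer A k / fact k * (1 / 2) ^ k" for k
    by (simp add: gbinomial_pochhammer mult_ac power_divide flip: power_mult_distrib)
  ultimately show ?thesis
    by (simp add: sums_iff)
qed

text \<open>From each term of the tail \<open>x ^ M\<close> is pulled out; what remains of the power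
  of \<open>x\<close> is at most \<open>(1 / 2) ^ k\<close>, so one convergent majorant serves all
  \<open>a\<close> and \<open>x\<close> at once.\<close>

lemma binomial_series_tail_bound:
  fixes A :: real
  obtains B where "B \<ge> 0" "\<And>a x :: complex. norm a \<le> A \<Longrightarrow> norm x \<le> 1 / 2 \<Longrightarrow>
    norm ((1 + x) powr a - (\<Sum>k<M. (a gchoose k) * x ^ k)) \<le> B * norm x ^ M"
proof -
  define b where "b = (\<lambda>k. \<bar>pochhammer A k / fact k\<bar> * (1 / 2) ^ k)"
  have nonneg: "b k \<ge> 0" for k
    by (simp add: b_def)
  have "summable (\<lambda>k. pochhammer \<bar>A\<bar> k / fact k * (1 / 2) ^ k)"
    by (rule summable_pochhammer_half)
  moreover have "norm (b k) \<le> pochhammer \<bar>A\<bar> k / fact k * (1 / 2) ^ k" for k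
  proof -
    have "\<bar>- A gchoose k\<bar> \<le> pochhammer \<bar>A\<bar> k / fact k"
      using norm_gbinomial_le[of "- A" "\<bar>A\<bar>" k] by simp
    then have "\<bar>pochhammer A k / fact k\<bar> \<le> pochhammer \<bar>A\<bar> k / fact k"
      by (simp add: gbinomial_pochhammer abs_mult power_abs)
    from mult_right_mono[OF this, of "(1 / 2) ^ k"] show ?thesis
      by (simp add: b_def)
  qed
  ultimately have "summable b"
    by (rule summable_comparison_test'[where N = 0])
  then have summable: "summable (\<lambda>k. b (k + M))"
    by (simp add: summable_iff_shift)
  show ?thesis
  proof
    show "0 \<le> 2 ^ M * (\<Sum>k. b (k + M))"
      by (intro mult_nonneg_nonneg suminf_nonneg summable nonneg) simp
    fix a x :: complex
    assume a: "norm a \<le> A" and x: "norm x \<le> 1 / 2"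
    have "(\<lambda>k. (a gchoose k) * x ^ k) sums (1 + x) powr a"
      using x by (intro gen_binomial_complex) simp
    then have "(\<lambda>k. (a gchoose (k + M)) * x ^ (k + M)) sums
        ((1 + x) powr a - (\<Sum>k<M. (a gchoose k) * x ^ k))"
      by (rule sums_split_initial_segment)
    then have eq: "(1 + x) powr a - (\<Sum>k<M. (a gchoose k) * x ^ k) = (\<Sum>k. (a gchoose (k + M)) * x ^ (k + M))"
      by (simp add: sums_iff)
    have "norm ((a gchoose (k + M)) * x ^ (k + M)) \<le> b (k + M) * (2 ^ M * norm x ^ M)" for k
    proof -
      have "norm (a gchoose (k + M)) \<le> \<bar>pochhammer A (k + M) / fact (k + M)\<bar>"
        using norm_gbinomial_le[OF a, of "k + M"] by linarith
      moreover have "norm x ^ (k + M) \<le> (1 / 2) ^ k * norm x ^ M"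
        unfolding power_add using x by (intro mult_right_mono power_mono) auto
      ultimately have "norm ((a gchoose (k + M)) * x ^ (k + M)) \<le>
          \<bar>pochhammer A (k + M) / fact (k + M)\<bar> * ((1 / 2) ^ k * norm x ^ M)"
        unfolding norm_mult norm_power by (intro mult_mono) auto
      also have "\<dots> = b (k + M) * (2 ^ M * norm x ^ M)"
        by (simp add: b_def power_add field_simps)
      finally show ?thesis .
    qed
    then have "norm (\<Sum>k. (a gchoose (k + M)) * x ^ (k + M)) \<le> (\<Sum>k. b (k + M) * (2 ^ M * norm x ^ M))"
      by (intro norm_suminf_le summable_mult2 summable)
    also have "\<dots> = (2 ^ M * (\<Sum>k. b (k + M))) * norm x ^ M"
      by (subst suminf_mult2[OF summable, symmetric]) simp
    finally show "norm ((1 + x) powr a - (\<Sum>k<M. (a gchoose k) * x ^ k)) \<le>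
        (2 ^ M * (\<Sum>k. b (k + M))) * norm x ^ M"
      unfolding eq .
  qed
qed

section \<open>The truncated formal solution and its defect\<close>

definition boole_coeff :: "nat \<Rightarrow> complex \<Rightarrow> complex" where
  "boole_coeff j z = (-1) ^ j * euler_poly j 0 / 2 * (pochhammer z j / fact j)"

text \<open>With \<open>D = d/dq\<close> the shift \<open>q -> q + 1\<close> is
  \<open>exp D\<close>, so the formal solution is \<open>1 / (1 + exp D)\<close> applied to
  \<open>q powr (- z)\<close>. Its expansion has the coefficients \<open>E_j(0) / (2 j!)\<close>,
  and \<open>D^j\<close> maps \<open>q powr (- z)\<close> to
  \<open>(-1)^j (z)_j q powr (- z - j)\<close>, which explains \<open>boole_coeff\<close>. Here the
  first \<open>N\<close> terms are kept.\<close>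

definition boole_main :: "nat \<Rightarrow> complex \<Rightarrow> complex \<Rightarrow> complex" where
  "boole_main N z q = q powr (- z) * (\<Sum>j<N. boole_coeff j z / q ^ j)"

definition boole_error :: "nat \<Rightarrow> complex \<Rightarrow> complex \<Rightarrow> complex" where
  "boole_error N z q = boole_main N z q + boole_main N z (q + 1) - q powr (- z)"

text \<open>The left side is the coefficient of \<open>x^n\<close>, \<open>x = 1 / q\<close>, in the
  formal sum of \<open>b_j x^j (1 + (1 + x) powr (- z - j))\<close>. As
  \<open>(z)_n = (z)_j (z + j)_(n-j)\<close>, the factor \<open>(z)_n / n!\<close> comes out and the
  recurrence for \<open>E_j(0)\<close> is left.\<close>

lemma boole_coeff_recurrence:
  "boole_coeff n z + (\<Sum>j\<le>n. boole_coeff j z * ((- z - of_nat j) gchoose (n - j))) = (if n = 0 then 1 else 0)"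
proof -
  have "boole_coeff j z * ((- z - of_nat j) gchoose (n - j)) =
      (-1) ^ n / 2 * (pochhammer z n / fact n) * (of_nat (n choose j) * euler_poly j 0)" if "j \<le> n" for j
  proof -
    have "(-1 :: complex) ^ n = (-1) ^ j * (-1) ^ (n - j)"
      using that by (simp flip: power_add)
    moreover have "pochhammer z n = pochhammer z j * pochhammer (z + of_nat j) (n - j)"
      using that by (rule pochhammer_product)
    ultimately show ?thesis
      using that by (simp add: boole_coeff_def gbinomial_pochhammer binomial_fact add.commute mult_ac)
  qed
  then have "boole_coeff n z + (\<Sum>j\<le>n. boole_coeff j z * ((- z - of_nat j) gchoose (n - j))) =
      (-1) ^ n / 2 * (pochhammer z n / fact n) *
        (euler_poly n 0 + (\<Sum>j\<le>n. of_nat (n choose j) * euler_poly j 0))"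
    by (simp add: boole_coeff_def sum_distrib_left distrib_left)
  then show ?thesis
    unfolding euler_poly_0_recurrence by simp
qed

lemma norm_boole_coeff_le:
  assumes "norm z \<le> S"
  shows "norm (boole_coeff j z) \<le> norm (euler_poly j 0) * (pochhammer S j / fact j)"
proof -
  have "norm (- z gchoose j) \<le> pochhammer S j / fact j"
    using assms by (intro norm_gbinomial_le) simp
  then have "norm (pochhammer z j / fact j) \<le> pochhammer S j / fact j"
    by (simp add: gbinomial_pochhammer norm_mult norm_divide norm_power)
  then have "norm (euler_poly j 0) / 2 * norm (pochhammer z j / fact j) \<le> norm (euler_poly j 0) * (pochhammer S j / fact j)"
    by (intro mult_mono) auto
  then show ?thesis
    by (simp add: boole_coeff_def norm_mult norm_divide norm_power)
qed

text \<open>After division by \<open>q powr (- z)\<close> the error is a power series in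
  \<open>x = 1 / q\<close>. All coefficients below \<open>x^N\<close> cancel by
  \<open>boole_coeff_recurrence\<close>, and only tails of binomial series survive.\<close>

lemma boole_error_bound:
  fixes S :: real
  assumes "N > 0"
  obtains C where "C \<ge> 0" "\<And>z q. norm z \<le> S \<Longrightarrow> q \<notin> \<real>\<^sub>\<le>\<^sub>0 \<Longrightarrow> norm q \<ge> 2 \<Longrightarrow>
    norm (boole_error N z q) \<le> C * norm (q powr (- z)) / norm q ^ N"
proof -
  \<comment> \<open>The \<open>j\<close>-th series is cut at \<open>N - j\<close>, because it will
    be multiplied by \<open>x^j\<close> and the total order has to be \<open>N\<close>.\<close>
  have "\<exists>B\<ge>0. \<forall>a x :: complex. norm a \<le> S + real j \<longrightarrow> norm x \<le> 1 / 2 \<longrightarrow>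
    norm ((1 + x) powr a - (\<Sum>k<N - j. (a gchoose k) * x ^ k)) \<le> B * norm x ^ (N - j)" for j
    by (rule binomial_series_tail_bound[of "S + real j" "N - j"]) blast
  then obtain B where B0: "\<And>j. B j \<ge> 0" and B: "\<And>j a x. norm a \<le> S + real j \<Longrightarrow> norm x \<le> 1 / 2 \<Longrightarrow>
    norm ((1 + x) powr a - (\<Sum>k<N - j. (a gchoose k) * x ^ k)) \<le> B j * norm (x::complex) ^ (N - j)"
    by metis
  define C where "C = (\<Sum>j<N. \<bar>norm (euler_poly j 0) * (pochhammer S j / fact j)\<bar> * B j)"
  have "C \<ge> 0"
    unfolding C_def by (intro sum_nonneg mult_nonneg_nonneg B0) auto
  moreover have "norm (boole_error N z q) \<le> C * norm (q powr (- z)) / norm q ^ N"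
    if z: "norm z \<le> S" and q: "q \<notin> \<real>\<^sub>\<le>\<^sub>0" "norm q \<ge> 2" for z q
  proof -
    define x where "x = 1 / q"
    define T where "T = (\<lambda>j. (1 + x) powr (- z - of_nat j) - (\<Sum>k<N - j. ((- z - of_nat j) gchoose k) * x ^ k))"
    have q0: "q \<noteq> 0" "q + 1 \<noteq> 0" "1 + x \<noteq> 0"
      using add_one_neq_0[OF q(1)] by (auto simp: x_def)
    have x: "norm x \<le> 1 / 2"
      using q(2) divide_left_mono[of 2 "norm q" 1] by (simp add: x_def norm_divide q0)
    have shift: "(q + 1) powr (- z) / (q + 1) ^ j = q powr (- z) * (x ^ j * (1 + x) powr (- z - of_nat j))" for j
    proof -
      have "(q + 1) powr (- z - of_nat j) = q powr (- z - of_nat j) * (1 + x) powr (- z - of_nat j)"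
        using q0 by (simp add: powr_def Ln_add_one[OF q(1)] x_def flip: exp_add) (simp add: algebra_simps)
      moreover have "w powr (- z - of_nat j) = w powr (- z) / w ^ j" if "w \<noteq> 0" for w
        using that by (simp add: powr_diff)
      ultimately show ?thesis
        using q0 by (simp add: x_def power_divide)
    qed
    \<comment> \<open>Collect by total degree \<open>n = j + k\<close>, so that the recurrence can
      be applied degree by degree.\<close>
    have "(\<Sum>j<N. boole_coeff j z * x ^ j * (\<Sum>k<N - j. ((- z - of_nat j) gchoose k) * x ^ k)) =
        (\<Sum>(j,k)\<in>{(j,k). j + k < N}. boole_coeff j z * ((- z - of_nat j) gchoose k) * x ^ (j + k))"
      unfolding sum_distrib_left
      by (subst sum.Sigma) (auto intro!: sum.cong simp: power_add)
    also have "\<dots> = (\<Sum>n<N. (\<Sum>j\<le>n. boole_coeff j z * ((- z - of_nat j) gchoose (n - j))) * x ^ n)"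
      unfolding sum.triangle_reindex sum_distrib_right by (auto intro!: sum.cong)
    finally have "(\<Sum>j<N. boole_coeff j z * x ^ j) +
        (\<Sum>j<N. boole_coeff j z * x ^ j * (\<Sum>k<N - j. ((- z - of_nat j) gchoose k) * x ^ k)) =
        (\<Sum>n<N. (if n = 0 then 1 else 0) * x ^ n)"
      by (simp only: flip: sum.distrib distrib_right) (simp only: boole_coeff_recurrence)
    also have "\<dots> = (\<Sum>n<N. if n = 0 then 1 else 0)"
      by (intro sum.cong) auto
    \<comment> \<open>\<open>N > 0\<close> puts the index \<open>n = 0\<close> into the
      range.\<close>
    also have "\<dots> = 1"
      using assms by simp
    finally have cancel: "(\<Sum>j<N. boole_coeff j z * x ^ j) +
        (\<Sum>j<N. boole_coeff j z * x ^ j * (\<Sum>k<N - j. ((- z - of_nat j) gchoose k) * x ^ k)) = 1" .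
    have "boole_main N z (q + 1) = (\<Sum>j<N. boole_coeff j z * ((q + 1) powr (- z) / (q + 1) ^ j))"
      by (simp add: boole_main_def sum_distrib_left algebra_simps)
    also have "\<dots> = q powr (- z) * (\<Sum>j<N. boole_coeff j z * x ^ j * (1 + x) powr (- z - of_nat j))"
      unfolding shift sum_distrib_left by (intro sum.cong) auto
    also have "(\<Sum>j<N. boole_coeff j z * x ^ j * (1 + x) powr (- z - of_nat j)) =
        (\<Sum>j<N. boole_coeff j z * x ^ j * T j) +
        (\<Sum>j<N. boole_coeff j z * x ^ j * (\<Sum>k<N - j. ((- z - of_nat j) gchoose k) * x ^ k))"
      unfolding T_def sum.distrib[symmetric] by (simp add: algebra_simps)
    finally have "boole_error N z q = q powr (- z) * ((\<Sum>j<N. boole_coeff j z * x ^ j * T j) +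
        ((\<Sum>j<N. boole_coeff j z * x ^ j) +
        (\<Sum>j<N. boole_coeff j z * x ^ j * (\<Sum>k<N - j. ((- z - of_nat j) gchoose k) * x ^ k))) - 1)"
      by (simp add: boole_error_def boole_main_def x_def power_divide algebra_simps)
    then have "boole_error N z q = q powr (- z) * (\<Sum>j<N. boole_coeff j z * x ^ j * T j)"
      unfolding cancel by simp
    moreover have "norm (\<Sum>j<N. boole_coeff j z * x ^ j * T j) \<le> C * norm x ^ N"
      unfolding C_def sum_distrib_right
    proof (rule sum_norm_le)
      fix j assume j: "j \<in> {..<N}"
      have "norm (- z - of_nat j) \<le> S + real j"
        using norm_triangle_ineq4[of "- z" "of_nat j"] z by simp
      then have T: "norm (T j) \<le> B j * norm x ^ (N - j)"
        unfolding T_def using x by (rule B)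
      have "norm (boole_coeff j z) \<le> \<bar>norm (euler_poly j 0) * (pochhammer S j / fact j)\<bar>"
        using norm_boole_coeff_le[OF z, of j] by linarith
      then have "norm (boole_coeff j z * x ^ j * T j) \<le>
          \<bar>norm (euler_poly j 0) * (pochhammer S j / fact j)\<bar> * norm x ^ j * (B j * norm x ^ (N - j))"
        unfolding norm_mult norm_power using T by (intro mult_mono) (auto intro!: mult_nonneg_nonneg)
      also have "\<dots> = \<bar>norm (euler_poly j 0) * (pochhammer S j / fact j)\<bar> * B j * norm x ^ N"
        using j by (simp add: mult_ac flip: power_add)
      finally show "norm (boole_coeff j z * x ^ j * T j) \<le>
        \<bar>norm (euler_poly j 0) * (pochhammer S j / fact j)\<bar> * B j * norm x ^ N" .
    qed
    ultimately have "norm (boole_error N z q) \<le> norm (q powr (- z)) * (C * norm x ^ N)"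
      by (simp add: norm_mult mult_left_mono)
    then show ?thesis
      by (simp add: x_def norm_divide power_divide mult_ac)
  qed
  ultimately show ?thesis
    using that by blast
qed

subsection \<open>Alternating summation\<close>

lemma norm_powr_complex_le:
  "norm (w powr z) \<le> norm w powr Re z * exp (\<bar>Im z\<bar> * pi)"
proof -
  have "\<bar>Im z * Arg w\<bar> \<le> \<bar>Im z\<bar> * pi"
    using mpi_less_Arg[of w] Arg_le_pi[of w] by (auto simp: abs_mult intro!: mult_left_mono)
  then have "- Im z * Arg w \<le> \<bar>Im z\<bar> * pi"
    by linarith
  then show ?thesis
    unfolding norm_powr_complex by (intro mult_left_mono) auto
qed

text \<open>The only geometric information on the sector that the estimates use. It passes from
  \<open>q\<close> to \<open>q + n\<close> with the same \<open>c\<close>, and it bounds all shifts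
  from below at once.\<close>

definition away_from_slit :: "real \<Rightarrow> complex \<Rightarrow> bool" where
  "away_from_slit c q \<longleftrightarrow> q \<notin> \<real>\<^sub>\<le>\<^sub>0 \<and> (\<forall>n. c * (norm q + real n) \<le> norm (q + of_nat n))"

lemma add_of_nat_notin_nonpos_Reals:
  fixes q :: complex
  assumes "q \<notin> \<real>\<^sub>\<le>\<^sub>0"
  shows "q + of_nat n \<notin> \<real>\<^sub>\<le>\<^sub>0"
  using assms by (auto simp: complex_nonpos_Reals_iff)

lemma away_from_slit_add_of_nat:
  assumes "away_from_slit c q" "c \<ge> 0"
  shows "away_from_slit c (q + of_nat k)"
proof -
  have "c * (norm (q + of_nat k) + real n) \<le> norm (q + of_nat k + of_nat n)" for n
  proof -
    have "c * (norm (q + of_nat k) + real n) \<le> c * (norm q + real (k + n))"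
      using norm_triangle_ineq[of q "of_nat k"] assms(2) by (intro mult_left_mono) auto
    also have "\<dots> \<le> norm (q + of_nat (k + n))"
      using assms(1) unfolding away_from_slit_def by blast
    finally show ?thesis
      by (simp add: add.assoc)
  qed
  then show ?thesis
    using assms add_of_nat_notin_nonpos_Reals by (auto simp: away_from_slit_def)
qed

text \<open>The decay exponent \<open>Re z + N\<close> is at least 2. Two powers are spent on
  \<open>1 / (1 + n)^2\<close>, which makes the errors summable over \<open>n\<close>; the others
  are kept as decay in \<open>norm q\<close>.\<close>

lemma boole_error_shift_bound:
  assumes c: "0 < c" "c \<le> 1" and S: "0 \<le> S" "S + 2 \<le> real N"
  obtains C where "C \<ge> 0" "\<And>z q n. norm z \<le> S \<Longrightarrow> away_from_slit c q \<Longrightarrow> 1 \<le> norm q \<Longrightarrow> 2 \<le> c * norm q \<Longrightarrow>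
    norm (boole_error N z (q + of_nat n)) \<le> C * norm q powr (2 - Re z - real N) * (1 / (1 + real n) ^ 2)"
proof -
  have "N > 0"
    using S by linarith
  from boole_error_bound[OF this, of S] obtain C where C: "C \<ge> 0"
    "\<And>z q. norm z \<le> S \<Longrightarrow> q \<notin> \<real>\<^sub>\<le>\<^sub>0 \<Longrightarrow> norm q \<ge> 2 \<Longrightarrow>
      norm (boole_error N z q) \<le> C * norm (q powr (- z)) / norm q ^ N"
    by blast
  \<comment> \<open>\<open>exp (S * pi)\<close> accounts for the argument in
    \<open>w powr (- z)\<close>, the power of \<open>c\<close> for replacing \<open>norm w\<close>
    by \<open>c * (norm q + n)\<close>.\<close>
  define D where "D = C * exp (S * pi) * c powr (- (S + real N))"
  have "D \<ge> 0"
    by (simp add: D_def C)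
  moreover have "norm (boole_error N z (q + of_nat n)) \<le> D * norm q powr (2 - Re z - real N) * (1 / (1 + real n) ^ 2)"
    if z: "norm z \<le> S" and q: "away_from_slit c q" "1 \<le> norm q" "2 \<le> c * norm q" for z q n
  proof -
    define w where "w = q + of_nat n"
    define p where "p = Re z + real N"
    define r where "r = norm q + real n"
    have p: "2 \<le> p" "p \<le> S + real N"
      using abs_Re_le_cmod[of z] z S by (auto simp: p_def)
    have r: "c * r \<le> norm w" "r > 0" "1 + real n \<le> r" "norm q \<le> r"
      using q by (auto simp: away_from_slit_def w_def r_def)
    have "2 \<le> c * r"
      using q(3) mult_left_mono[OF r(4), of c] c by linarith
    then have w: "norm w \<ge> 2" "w \<notin> \<real>\<^sub>\<le>\<^sub>0" "c * r > 0"
      using r q(1) add_of_nat_notin_nonpos_Reals by (auto simp: w_def away_from_slit_def)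
    have "norm (w powr (- z)) \<le> norm w powr (- Re z) * exp (\<bar>Im z\<bar> * pi)"
      using norm_powr_complex_le[of w "- z"] by simp
    also have "\<dots> \<le> norm w powr (- Re z) * exp (S * pi)"
      using abs_Im_le_cmod[of z] z by (intro mult_left_mono) (auto intro!: mult_right_mono)
    finally have "norm (w powr (- z)) / norm w ^ N \<le> norm w powr (- Re z) * exp (S * pi) / norm w ^ N"
      by (intro divide_right_mono) auto
    also have "\<dots> = exp (S * pi) * norm w powr (- p)"
    proof -
      have "norm w powr real N = norm w ^ N"
        using w by (intro powr_realpow) linarith
      then show ?thesis
        by (simp add: p_def powr_diff)
    qed
    also have "norm w powr (- p) \<le> (c * r) powr (- p)"
      using w p r by (intro powr_mono2') auto
    also have "\<dots> = c powr (- p) * (r powr (2 - p) * (1 / r ^ 2))"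
      using c r by (simp add: powr_mult powr_diff powr_minus powr_realpow field_simps)
    \<comment> \<open>Here \<open>c \<le> 1\<close> and \<open>p \<le> S + N\<close> remove
      \<open>z\<close> from the constant, and \<open>2 - p \<le> 0\<close> allows \<open>r\<close>
      to be lowered to \<open>norm q\<close>.\<close>
    also have "\<dots> \<le> c powr (- (S + real N)) * (norm q powr (2 - p) * (1 / (1 + real n) ^ 2))"
    proof (intro mult_mono)
      show "c powr - p \<le> c powr - (S + real N)"
        using p c by (intro powr_mono') auto
      show "r powr (2 - p) \<le> norm q powr (2 - p)"
        using p r q by (intro powr_mono2') auto
      show "1 / r ^ 2 \<le> 1 / (1 + real n) ^ 2"
        using r by (intro divide_left_mono power_mono) auto
    qed (use r in auto)
    finally have *: "norm (w powr (- z)) / norm w ^ N \<le>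
        exp (S * pi) * (c powr (- (S + real N)) * (norm q powr (2 - p) * (1 / (1 + real n) ^ 2)))"
      by simp
    have "norm (boole_error N z w) \<le> C * (norm (w powr (- z)) / norm w ^ N)"
      using C(2)[OF z w(2,1)] by simp
    also have "\<dots> \<le> C * (exp (S * pi) * (c powr (- (S + real N)) * (norm q powr (2 - p) * (1 / (1 + real n) ^ 2))))"
      by (intro mult_left_mono * C)
    finally show ?thesis
      by (simp add: D_def w_def p_def algebra_simps)
  qed
  ultimately show ?thesis
    using that by blast
qed

text \<open>Each \<open>(q + n) powr (- z)\<close> equals \<open>P(q + n) + P(q + n + 1)\<close>
  minus the error, and the alternating sum of the \<open>P\<close> terms telescopes.\<close>

lemma boole_summation:
  "(\<Sum>n<M. (-1) ^ n * (q + of_nat n) powr (- z)) =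
    boole_main N z q - (-1) ^ M * boole_main N z (q + of_nat M) - (\<Sum>n<M. (-1) ^ n * boole_error N z (q + of_nat n))"
  by (induction M) (auto simp: boole_error_def algebra_simps)

lemma boole_main_tendsto_0:
  assumes z: "Re z > 0" and q: "away_from_slit c q" "c > 0" "1 \<le> c * norm q"
  shows "(\<lambda>M. boole_main N z (q + of_nat M)) \<longlonglongrightarrow> 0"
proof -
  have q_le: "c * (norm q + real M) \<le> norm (q + of_nat M)" for M
    using q by (auto simp: away_from_slit_def)
  have "filterlim (\<lambda>M. c * (norm q + real M)) at_top sequentially"
    using q by real_asymp
  then have lim: "filterlim (\<lambda>M. norm (q + of_nat M)) at_top sequentially"
    by (rule filterlim_at_top_mono) (simp add: q_le)
  define B where "B = exp (\<bar>Im z\<bar> * pi) * (\<Sum>j<N. norm (boole_coeff j z))"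
  have "(\<lambda>M. norm (q + of_nat M) powr (- Re z) * B) \<longlonglongrightarrow> 0"
    by (intro tendsto_mult_left_zero tendsto_neg_powr lim) (use z in auto)
  moreover have "norm (boole_main N z (q + of_nat M)) \<le> norm (q + of_nat M) powr (- Re z) * B" for M
  proof -
    have "c * norm q \<le> c * (norm q + real M)"
      using q by (intro mult_left_mono) auto
    then have "norm (q + of_nat M) \<ge> 1"
      using q_le[of M] q by linarith
    then have "norm (boole_coeff j z / (q + of_nat M) ^ j) \<le> norm (boole_coeff j z)" for j
      using one_le_power[of "norm (q + of_nat M)" j]
      by (simp add: norm_divide norm_power divide_le_eq mult_le_cancel_left1)
    then have "norm (\<Sum>j<N. boole_coeff j z / (q + of_nat M) ^ j) \<le> (\<Sum>j<N. norm (boole_coeff j z))"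
      by (intro sum_norm_le)
    moreover have "norm ((q + of_nat M) powr (- z)) \<le> norm (q + of_nat M) powr (- Re z) * exp (\<bar>Im z\<bar> * pi)"
      using norm_powr_complex_le[of "q + of_nat M" "- z"] by simp
    ultimately show ?thesis
      unfolding boole_main_def B_def norm_mult mult.assoc[symmetric] by (intro mult_mono) auto
  qed
  ultimately show ?thesis
    using Lim_null_comparison by (metis (no_types, lifting) always_eventually)
qed

lemma holomorphic_boole_main:
  "q \<noteq> 0 \<Longrightarrow> (\<lambda>z. boole_main N z q) holomorphic_on A"
  unfolding boole_main_def boole_coeff_def by (intro holomorphic_intros) auto

text \<open>\<open>R\<close> is minus the alternating sum of the errors. That sum converges on the
  whole ball, also where \<open>Re z \<le> 0\<close>, so \<open>boole_main N z q + R z\<close>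
  continues the series; \<open>D\<close> is the same for all \<open>q\<close>.\<close>

lemma boole_expansion:
  assumes c: "0 < c" "c \<le> 1" and S: "0 \<le> S" "S + 2 \<le> real N"
  obtains D where "\<And>q. away_from_slit c q \<Longrightarrow> 1 \<le> norm q \<Longrightarrow> 2 \<le> c * norm q \<Longrightarrow>
    \<exists>R. R holomorphic_on ball 0 S \<and>
      (\<forall>z\<in>ball 0 S. norm (R z) \<le> D * norm q powr (2 - Re z - real N)) \<and>
      (\<forall>z\<in>ball 0 S. Re z > 0 \<longrightarrow> (\<lambda>n. (-1) ^ n / (of_nat n + q) powr z) sums (boole_main N z q + R z))"
proof -
  from boole_error_shift_bound[OF assms] obtain C where C: "C \<ge> 0"
    "\<And>z q n. norm z \<le> S \<Longrightarrow> away_from_slit c q \<Longrightarrow> 1 \<le> norm q \<Longrightarrow> 2 \<le> c * norm q \<Longrightarrow>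
      norm (boole_error N z (q + of_nat n)) \<le> C * norm q powr (2 - Re z - real N) * (1 / (1 + real n) ^ 2)"
    by blast
  define Z where "Z = (\<Sum>n. 1 / (1 + real n) ^ 2)"
  have Z: "summable (\<lambda>n. 1 / (1 + real n) ^ 2)"
    using summable_Suc_iff[of "\<lambda>n. inverse (real n ^ 2)"] inverse_power_summable[of 2, where ?'a = real]
    by (simp add: inverse_eq_divide)
  show ?thesis
  proof
    fix q assume q: "away_from_slit c q" "1 \<le> norm q" "2 \<le> c * norm q"
    define e where "e = (\<lambda>n z. (-1) ^ n * boole_error N z (q + of_nat n))"
    define R where "R = (\<lambda>z. - (\<Sum>n. e n z))"
    have e_le: "norm (e n z) \<le> C * norm q powr (2 - Re z - real N) * (1 / (1 + real n) ^ 2)" if "norm z \<le> S" for n z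
      using C(2)[OF that q, of n] by (simp add: e_def norm_mult norm_power)
    have summable_e: "summable (\<lambda>n. e n z)" if "norm z \<le> S" for z
      by (rule summable_comparison_test'[OF summable_mult[OF Z], of 0]) (rule e_le[OF that])
    have q_nz: "q + of_nat n \<noteq> 0" "q + of_nat n + 1 \<noteq> 0" for n
      using add_one_neq_0[OF add_of_nat_notin_nonpos_Reals[of q n]] q by (auto simp: away_from_slit_def)
    have "(\<lambda>z. \<Sum>n. e n z) holomorphic_on ball 0 S"
    proof (rule holomorphic_uniform_sequence)
      show "(\<lambda>z. \<Sum>n<M. e n z) holomorphic_on ball 0 S" for M
        unfolding e_def boole_error_def
        using q_nz by (intro holomorphic_intros holomorphic_boole_main) auto
      have *: "uniform_limit (ball 0 S) (\<lambda>M z. \<Sum>n<M. e n z) (\<lambda>z. \<Sum>n. e n z) sequentially"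
      proof (rule Weierstrass_m_test)
        fix n and z :: complex
        assume "z \<in> ball 0 S"
        then have z: "norm z \<le> S"
          by simp
        \<comment> \<open>The exponent is not positive since \<open>S + 2 \<le> N\<close>; this
          makes the Weierstrass majorant independent of \<open>z\<close>.\<close>
        have "norm q powr (2 - Re z - real N) \<le> norm q powr 0"
          using abs_Re_le_cmod[of z] z S q by (intro powr_mono) auto
        then have "norm q powr (2 - Re z - real N) \<le> 1"
          using q by (simp split: if_splits)
        then have "C * norm q powr (2 - Re z - real N) * (1 / (1 + real n) ^ 2) \<le> C * 1 * (1 / (1 + real n) ^ 2)"
          using C by (intro mult_right_mono mult_left_mono) auto
        then show "norm (e n z) \<le> C * (1 / (1 + real n) ^ 2)"
          using e_le[OF z, of n] by simp
      qed (intro summable_mult Z)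
      show "\<exists>d>0. cball z d \<subseteq> ball 0 S \<and> uniform_limit (cball z d) (\<lambda>M z. \<Sum>n<M. e n z) (\<lambda>z. \<Sum>n. e n z) sequentially"
        if "z \<in> ball 0 S" for z
      proof -
        obtain d where "d > 0" "cball z d \<subseteq> ball 0 S"
          using open_contains_cball[of "ball 0 S"] \<open>z \<in> ball 0 S\<close> by blast
        then show ?thesis
          using uniform_limit_on_subset[OF *] by blast
      qed
    qed simp
    then have "R holomorphic_on ball 0 S"
      unfolding R_def by (intro holomorphic_intros)
    moreover have "norm (R z) \<le> C * Z * norm q powr (2 - Re z - real N)" if "z \<in> ball 0 S" for z
    proof -
      have z: "norm z \<le> S"
        using that by simp
      have "norm (\<Sum>n. e n z) \<le> (\<Sum>n. C * norm q powr (2 - Re z - real N) * (1 / (1 + real n) ^ 2))"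
        by (intro norm_suminf_le summable_mult Z e_le z)
      also have "\<dots> = C * norm q powr (2 - Re z - real N) * Z"
        unfolding Z_def by (intro suminf_mult Z)
      finally show ?thesis
        by (simp add: R_def mult_ac)
    qed
    moreover have "(\<lambda>n. (-1) ^ n / (of_nat n + q) powr z) sums (boole_main N z q + R z)"
      if "z \<in> ball 0 S" "Re z > 0" for z
    proof -
      \<comment> \<open>The boundary term of the telescoping sum dies out only thanks to
        \<open>Re z > 0\<close>.\<close>
      have "(\<lambda>M. (-1) ^ M * boole_main N z (q + of_nat M)) \<longlonglongrightarrow> 0"
        using boole_main_tendsto_0[OF that(2) q(1) c(1), of N] q(3)
        by (subst tendsto_norm_zero_iff[symmetric]) (simp add: norm_mult norm_power tendsto_norm_zero)
      moreover have "(\<lambda>M. \<Sum>n<M. e n z) \<longlonglongrightarrow> (\<Sum>n. e n z)"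
        using summable_e[of z] that by (simp add: summable_LIMSEQ)
      ultimately have "(\<lambda>M. boole_main N z q - (-1) ^ M * boole_main N z (q + of_nat M) - (\<Sum>n<M. e n z))
          \<longlonglongrightarrow> boole_main N z q - 0 - (\<Sum>n. e n z)"
        by (intro tendsto_intros)
      then have "(\<lambda>n. (-1) ^ n * (q + of_nat n) powr (- z)) sums (boole_main N z q + R z)"
        unfolding sums_def boole_summation[where N = N] by (simp add: R_def e_def)
      then show ?thesis
        by (simp add: powr_minus field_simps)
    qed
    ultimately show "\<exists>R. R holomorphic_on ball 0 S \<and>
      (\<forall>z\<in>ball 0 S. norm (R z) \<le> C * Z * norm q powr (2 - Re z - real N)) \<and>
      (\<forall>z\<in>ball 0 S. Re z > 0 \<longrightarrow> (\<lambda>n. (-1) ^ n / (of_nat n + q) powr z) sums (boole_main N z q + R z))"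
      by blast
  qed
qed

section \<open>Geometry of the sector\<close>

lemma sector_away_from_slit:
  assumes "\<delta> > 0"
  obtains c where "0 < c" "c \<le> 1" "\<And>q. q \<in> sector \<delta> \<Longrightarrow> away_from_slit c q"
proof -
  \<comment> \<open>The minimum keeps \<open>d / 2\<close> inside \<open>(0, pi / 2]\<close>,
    however large \<open>\<delta>\<close> is.\<close>
  define d where "d = min \<delta> pi"
  define c where "c = sin (d / 2)"
  have d: "0 < d" "d \<le> pi"
    using assms by (auto simp: d_def)
  have "0 < c"
    unfolding c_def using d by (intro sin_gt_zero) auto
  have cos_d: "cos d = 1 - 2 * c ^ 2"
    using cos_double_sin[of "d / 2"] by (simp add: c_def)
  have "away_from_slit c q" if "q \<in> sector \<delta>" for q
  proof -
    have q: "q \<noteq> 0" "\<bar>Arg q\<bar> \<le> pi - d"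
      using that by (auto simp: sector_def d_def)
    have "Arg q \<noteq> pi"
      using q d by auto
    then have "q \<notin> \<real>\<^sub>\<le>\<^sub>0"
      using q(1) by (auto simp: Arg_eq_pi complex_nonpos_Reals_iff complex_eq_iff)
    have "cos (pi - d) \<le> cos \<bar>Arg q\<bar>"
      using q(2) d by (intro cos_monotone_0_pi_le) auto
    then have "- cos d * norm q \<le> cos (Arg q) * norm q"
      by (intro mult_right_mono) auto
    also have "cos (Arg q) * norm q = Re q"
      using q(1) by (simp add: cos_Arg)
    finally have Re: "- cos d * norm q \<le> Re q" .
    have "c * (norm q + real n) \<le> norm (q + of_nat n)" for n
    proof (rule power2_le_imp_le)
      \<comment> \<open>By the law of cosines, with \<open>cos (Arg q) \<ge> - cos d\<close>, this
        square is a lower bound for the difference of the two sides; the choice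
        \<open>c = sin (d / 2)\<close> makes it a perfect square.\<close>
      have "0 \<le> (1 + cos d) * (norm q - real n) ^ 2 / 2"
        using cos_ge_minus_one[of d] by (intro divide_nonneg_pos mult_nonneg_nonneg) (auto simp del: cos_ge_minus_one)
      also have "\<dots> = norm q ^ 2 + real n ^ 2 - 2 * real n * cos d * norm q - c ^ 2 * (norm q + real n) ^ 2"
        unfolding cos_d by (simp add: field_simps power2_eq_square)
      finally have "c ^ 2 * (norm q + real n) ^ 2 \<le> norm q ^ 2 + real n ^ 2 + 2 * real n * (- cos d * norm q)"
        by simp
      also have "\<dots> \<le> norm q ^ 2 + real n ^ 2 + 2 * real n * Re q"
        using Re by (intro add_left_mono mult_left_mono) auto
      also have "\<dots> = norm (q + of_nat n) ^ 2"
        unfolding cmod_power2 by (simp add: power2_eq_square algebra_simps)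
      finally show "(c * (norm q + real n)) ^ 2 \<le> norm (q + of_nat n) ^ 2"
        by (simp add: power_mult_distrib)
    qed simp
    with \<open>q \<notin> _\<close> show ?thesis
      by (simp add: away_from_slit_def)
  qed
  with \<open>0 < c\<close> show ?thesis
    using that[of c] by (simp add: c_def)
qed

subsection \<open>Analytic continuation\<close>

lemma holomorphic_eq_on_ball:
  assumes "f holomorphic_on ball 0 r" "g holomorphic_on ball 0 r"
    and "\<And>z. z \<in> ball 0 r \<Longrightarrow> Re z > 0 \<Longrightarrow> f z = g z" and "z \<in> ball 0 r"
  shows "f z = g z"
proof (rule analytic_continuation_open[where f = f and g = g and s' = "ball 0 r" and s = "ball 0 r \<inter> {z. Re z > 0}"])
  show "open (ball 0 r \<inter> {z. Re z > 0})"
    by (intro open_Int open_ball open_halfspace_Re_gt)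
  have "r > 0"
    using assms(4) by (metis ball_eq_empty empty_iff not_le)
  then have "of_real (r / 2) \<in> ball (0 :: complex) r \<inter> {z. Re z > 0}"
    by simp
  then show "ball (0 :: complex) r \<inter> {z. Re z > 0} \<noteq> {}"
    by blast
qed (use assms in auto)

text \<open>By the identity theorem the functions on two concentric balls agree on the smaller one,
  so they glue together.\<close>

lemma entire_extension_from_balls:
  assumes "\<And>n :: nat. \<exists>f. f holomorphic_on ball 0 (real n) \<and> (\<forall>z\<in>ball 0 (real n). Re z > 0 \<longrightarrow> f z = g z)"
  shows "\<exists>f. f holomorphic_on UNIV \<and> (\<forall>z. Re z > 0 \<longrightarrow> f z = g z)"
proof -
  from assms obtain F where hol: "\<And>n. F n holomorphic_on ball 0 (real n)"
    and F: "\<And>n z. z \<in> ball 0 (real n) \<Longrightarrow> Re z > 0 \<Longrightarrow> F n z = g z"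
    by metis
  have F_eq: "F m z = F n z" if "m \<le> n" "z \<in> ball 0 (real m)" for m n z
  proof (rule holomorphic_eq_on_ball[where f = "F m" and g = "F n" and r = "real m"])
    show "F n holomorphic_on ball 0 (real m)"
      using hol[of n] by (rule holomorphic_on_subset) (use that in auto)
  qed (use that hol F in auto)
  define f where "f = (\<lambda>z. F (Suc (nat \<lceil>norm z\<rceil>)) z)"
  have z_in: "z \<in> ball 0 (real (Suc (nat \<lceil>norm z\<rceil>)))" for z :: complex
    by (simp, linarith)
  have f_eq: "f z = F n z" if "z \<in> ball 0 (real n)" for n z
    unfolding f_def using F_eq[OF _ that] F_eq[OF _ z_in[of z]] by (metis nat_le_linear)
  have "f holomorphic_on (\<Union>n. ball 0 (real n))"
  proof (rule holomorphic_on_UN_open)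
    show "f holomorphic_on ball 0 (real n)" for n
      using hol[of n] by (rule holomorphic_transform) (simp add: f_eq)
  qed auto
  moreover have "(\<Union>n. ball 0 (real n)) = (UNIV :: complex set)"
    using z_in by blast
  ultimately have "f holomorphic_on UNIV"
    by simp
  moreover have "f z = g z" if "Re z > 0" for z
    using F[OF z_in that] by (simp add: f_def)
  ultimately show ?thesis
    by blast
qed

text \<open>\<open>boole_expansion\<close> needs \<open>q\<close> of large modulus. Splitting off
  the first \<open>k\<close> terms, which are entire in \<open>z\<close>, replaces \<open>q\<close>
  by \<open>p = q + k\<close>.\<close>

lemma alt_hurwitz_series_continuation:
  assumes c: "0 < c" "c \<le> 1" and q: "away_from_slit c q"
  shows "\<exists>f. f holomorphic_on UNIV \<and> (\<forall>z. Re z > 0 \<longrightarrow> (\<lambda>n. (-1) ^ n / (of_nat n + q) powr z) sums f z)"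
proof -
  \<comment> \<open>With this \<open>k\<close> two uses of the factor \<open>c\<close> give
    \<open>c * norm p \<ge> c * (c * k) \<ge> 2\<close>.\<close>
  obtain k where k: "2 / c ^ 2 \<le> real k"
    using real_arch_simple by blast
  define p where "p = q + of_nat k"
  have "2 \<le> c * (c * real k)"
    using k c by (simp add: field_simps power2_eq_square)
  also have "\<dots> \<le> c * (c * (norm q + real k))"
    using c by (intro mult_left_mono) auto
  also have "\<dots> \<le> c * norm p"
    using q c by (intro mult_left_mono) (auto simp: p_def away_from_slit_def)
  finally have p2: "2 \<le> c * norm p" .
  also have "\<dots> \<le> 1 * norm p"
    using c by (intro mult_right_mono) auto
  finally have p1: "1 \<le> norm p"
    by simp
  have p: "away_from_slit c p"
    unfolding p_def using q c by (intro away_from_slit_add_of_nat) auto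
  have q_nz: "of_nat i + q \<noteq> 0" for i
    using add_of_nat_notin_nonpos_Reals[of q i] q by (auto simp: away_from_slit_def add.commute)
  have local: "\<exists>f. f holomorphic_on ball 0 (real n) \<and>
      (\<forall>z\<in>ball 0 (real n). Re z > 0 \<longrightarrow> (\<lambda>n. (-1) ^ n / (of_nat n + q) powr z) sums f z)" for n
  proof -
    obtain R where R: "R holomorphic_on ball 0 (real n)"
      "\<forall>z\<in>ball 0 (real n). Re z > 0 \<longrightarrow> (\<lambda>i. (-1) ^ i / (of_nat i + p) powr z) sums (boole_main (n + 2) z p + R z)"
      by (rule boole_expansion[OF c, of "real n" "n + 2"], simp, simp) (use p p1 p2 in blast)
    define f where "f = (\<lambda>z. (-1) ^ k * (boole_main (n + 2) z p + R z) + (\<Sum>i<k. (-1) ^ i / (of_nat i + q) powr z))"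
    have "f holomorphic_on ball 0 (real n)"
      unfolding f_def using q_nz p1
      by (intro holomorphic_intros holomorphic_boole_main R) auto
    moreover have "(\<lambda>n. (-1) ^ n / (of_nat n + q) powr z) sums f z" if "z \<in> ball 0 (real n)" "Re z > 0" for z
    proof -
      have "(\<lambda>i. (-1) ^ k * ((-1) ^ i / (of_nat i + p) powr z)) sums ((-1) ^ k * (boole_main (n + 2) z p + R z))"
        using R that by (intro sums_mult) auto
      then have "(\<lambda>i. (-1) ^ (i + k) / (of_nat (i + k) + q) powr z) sums ((-1) ^ k * (boole_main (n + 2) z p + R z))"
        by (simp add: p_def power_add mult_ac add_ac)
      then show ?thesis
        unfolding f_def sums_iff_shift[where f = "\<lambda>n. (-1) ^ n / (of_nat n + q) powr z"] .
    qed
    ultimately show ?thesis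
      by blast
  qed
  have "\<exists>f. f holomorphic_on UNIV \<and> (\<forall>z. Re z > 0 \<longrightarrow> f z = (\<Sum>n. (-1) ^ n / (of_nat n + q) powr z))"
  proof (rule entire_extension_from_balls)
    fix n :: nat
    obtain f where "f holomorphic_on ball 0 (real n)"
      "\<forall>z\<in>ball 0 (real n). Re z > 0 \<longrightarrow> (\<lambda>n. (-1) ^ n / (of_nat n + q) powr z) sums f z"
      using local[of n] by blast
    then show "\<exists>f. f holomorphic_on ball 0 (real n) \<and>
        (\<forall>z\<in>ball 0 (real n). Re z > 0 \<longrightarrow> f z = (\<Sum>n. (-1) ^ n / (of_nat n + q) powr z))"
      by (intro exI[of _ f]) (auto dest: sums_unique)
  qed
  moreover have "summable (\<lambda>n. (-1) ^ n / (of_nat n + q) powr z)" if "Re z > 0" for z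
  proof -
    obtain n where "norm z < real n"
      using reals_Archimedean2 by blast
    then have z: "z \<in> ball 0 (real n)"
      by simp
    obtain f where "\<forall>z\<in>ball 0 (real n). Re z > 0 \<longrightarrow> (\<lambda>n. (-1) ^ n / (of_nat n + q) powr z) sums f z"
      using local[of n] by blast
    with z that have "(\<lambda>n. (-1) ^ n / (of_nat n + q) powr z) sums f z"
      by blast
    then show ?thesis
      by (rule sums_summable)
  qed
  ultimately show ?thesis
    by (auto simp: summable_sums)
qed

text \<open>Existence is the continuation above, uniqueness the identity theorem; together they make
  the definite description in \<open>alt_hurwitz_zeta\<close> meaningful.\<close>

lemma alt_hurwitz_zeta:
  assumes "0 < c" "c \<le> 1" "away_from_slit c q"
  shows holomorphic_alt_hurwitz_zeta: "(\<lambda>z. alt_hurwitz_zeta z q) holomorphic_on UNIV"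
    and alt_hurwitz_zeta_sums:
      "\<And>z. Re z > 0 \<Longrightarrow> (\<lambda>n. (-1) ^ n / (of_nat n + q) powr z) sums alt_hurwitz_zeta z q"
proof -
  define P where "P = (\<lambda>f. f holomorphic_on UNIV \<and>
    (\<forall>z. Re z > 0 \<longrightarrow> (\<lambda>n. (-1) ^ n / (of_nat n + q) powr z) sums f z))"
  have "f = g" if f: "P f" and g: "P g" for f g
  proof
    fix z :: complex
    have hol: "f holomorphic_on ball 0 r" "g holomorphic_on ball 0 r" for r
      using f g unfolding P_def by (auto intro: holomorphic_on_subset[OF _ subset_UNIV])
    have eq: "f w = g w" if "Re w > 0" for w
    proof (rule sums_unique2)
      show "(\<lambda>n. (-1) ^ n / (of_nat n + q) powr w) sums f w"
        "(\<lambda>n. (-1) ^ n / (of_nat n + q) powr w) sums g w"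
        using f g that unfolding P_def by blast+
    qed
    obtain r where "norm z < r"
      using gt_ex by blast
    then have "z \<in> ball 0 r"
      by simp
    with hol eq show "f z = g z"
      by (rule holomorphic_eq_on_ball)
  qed
  with alt_hurwitz_series_continuation[OF assms] have "\<exists>!f. P f"
    unfolding P_def by blast
  then have "P (THE f. P f)"
    by (rule theI')
  moreover have "(\<lambda>z. alt_hurwitz_zeta z q) = (THE f. P f)"
    unfolding alt_hurwitz_zeta_def P_def by simp
  ultimately have "P (\<lambda>z. alt_hurwitz_zeta z q)"
    by simp
  then show "(\<lambda>z. alt_hurwitz_zeta z q) holomorphic_on UNIV"
    "\<And>z. Re z > 0 \<Longrightarrow> (\<lambda>n. (-1) ^ n / (of_nat n + q) powr z) sums alt_hurwitz_zeta z q"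
    unfolding P_def by blast+
qed

subsection \<open>The asymptotic expansion\<close>

lemma holomorphic_deriv_plus_log:
  "f holomorphic_on UNIV \<Longrightarrow> (deriv_plus_log q ^^ m) f holomorphic_on UNIV"
  by (induction m) (auto simp: deriv_plus_log_def intro!: holomorphic_intros)

lemma higher_deriv_powr_mult:
  assumes q: "q \<noteq> 0" and f: "f holomorphic_on UNIV"
  shows "(deriv ^^ m) (\<lambda>z. q powr z * f z) = (\<lambda>z. q powr z * (deriv_plus_log q ^^ m) f z)"
proof (induction m)
  case 0
  then show ?case by simp
next
  case (Suc m)
  define h where "h = (deriv_plus_log q ^^ m) f"
  have "h holomorphic_on UNIV"
    unfolding h_def by (rule holomorphic_deriv_plus_log[OF f])
  then have "(h has_field_derivative deriv h z) (at z)" for z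
    by (simp add: holomorphic_derivI)
  then have "((\<lambda>z. q powr z * h z) has_field_derivative q powr z * deriv_plus_log q h z) (at z)" for z
    using q by (auto intro!: derivative_eq_intros simp: deriv_plus_log_def algebra_simps)
  then have "deriv (\<lambda>z. q powr z * h z) = (\<lambda>z. q powr z * deriv_plus_log q h z)"
    by (intro ext DERIV_imp_deriv)
  then show ?case
    by (simp add: Suc.IH h_def)
qed

text \<open>The Leibniz rule for \<open>q powr z * f z\<close>, divided by
  \<open>q powr z\<close>.\<close>

lemma deriv_plus_log_binomial:
  assumes q: "q \<noteq> 0" and f: "f holomorphic_on UNIV"
  shows "(deriv_plus_log q ^^ m) f z = (\<Sum>j=0..m. of_nat (m choose j) * (deriv ^^ (m - j)) f z * Ln q ^ j)"
proof -
  have "(deriv_plus_log q ^^ i) (\<lambda>_. 1) = (\<lambda>_. Ln q ^ i)" for i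
    by (induction i) (auto simp: deriv_plus_log_def)
  then have powr: "(deriv ^^ i) (\<lambda>z. q powr z) z = q powr z * Ln q ^ i" for i
    using higher_deriv_powr_mult[OF q, of "\<lambda>_. 1" i] by simp
  have "q powr z * (deriv_plus_log q ^^ m) f z = (deriv ^^ m) (\<lambda>z. q powr z * f z) z"
    by (simp add: higher_deriv_powr_mult[OF q f])
  also have "\<dots> = (\<Sum>j=0..m. of_nat (m choose j) * (deriv ^^ j) (\<lambda>z. q powr z) z * (deriv ^^ (m - j)) f z)"
    by (rule higher_deriv_mult[where S = UNIV]) (use q in \<open>auto intro!: holomorphic_intros f\<close>)
  also have "\<dots> = q powr z * (\<Sum>j=0..m. of_nat (m choose j) * (deriv ^^ (m - j)) f z * Ln q ^ j)"
    unfolding powr sum_distrib_left by (intro sum.cong) auto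
  finally show ?thesis
    using q by simp
qed

lemma higher_deriv_sum_nested_sum:
  "(deriv ^^ m) (\<lambda>z. \<Sum>j\<in>A. b j * nested_sum z 0 j) = (\<lambda>z. \<Sum>j\<in>A. b j * nested_sum z m j)"
proof (induction m)
  case (Suc m)
  have "((\<lambda>z. \<Sum>j\<in>A. b j * nested_sum z m j) has_field_derivative (\<Sum>j\<in>A. b j * nested_sum z (Suc m) j)) (at z)" for z
    by (intro DERIV_sum DERIV_cmult has_field_derivative_nested_sum)
  then have "deriv (\<lambda>z. \<Sum>j\<in>A. b j * nested_sum z m j) = (\<lambda>z. \<Sum>j\<in>A. b j * nested_sum z (Suc m) j)"
    by (intro ext DERIV_imp_deriv)
  then show ?case
    by (simp add: Suc.IH del: nested_sum.simps)
qed simp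

text \<open>Even \<open>j > 0\<close> drop out since \<open>E_j(0) = 0\<close>, and
  \<open>j = 0, 1\<close> since \<open>m \<ge> 2\<close>. The odd \<open>j = 2k + 1\<close> with
  \<open>k \<ge> 1\<close> remain and carry \<open>c_coeff m k s\<close>; their sign gives the
  factor \<open>- 1 / 2\<close>.\<close>

lemma boole_coeff_higher_deriv_sum:
  assumes "m \<ge> 2" "q \<noteq> 0"
  shows "(\<Sum>j<2 * K + 3. (-1) ^ j * euler_poly j 0 / 2 / q ^ j * nested_sum s m j) =
    - 1 / 2 * (q powr s * Sigma_trunc m K s q)"
proof (induction K)
  case 0
  have "{..<2 * 0 + 3} = {0, 1, 2 :: nat}"
    by auto
  then show ?case
    using assms by (simp add: nested_sum_eq_0 euler_poly_0_even Sigma_trunc_def)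
next
  case (Suc K)
  define t where "t = (\<lambda>j. (-1) ^ j * euler_poly j 0 / 2 / q ^ j * nested_sum s m j)"
  have powr: "q powr s * q powr (- s - 2 * of_nat (Suc K) - 1) = 1 / q ^ (2 * K + 3)"
  proof -
    have "q powr s * q powr (- s - 2 * of_nat (Suc K) - 1) = q powr (- of_nat (2 * K + 3))"
      unfolding powr_add[symmetric] by (simp add: algebra_simps)
    also have "\<dots> = 1 / q ^ (2 * K + 3)"
      unfolding powr_minus powr_complexpow[OF assms(2)] inverse_eq_divide ..
    finally show ?thesis .
  qed
  have "t (2 * K + 3) = - 1 / 2 * (1 / q ^ (2 * K + 3) * c_coeff m (Suc K) s)"
    by (simp add: t_def c_coeff_def numeral_3_eq_3)
  moreover have "Sigma_trunc m (Suc K) s q =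
      Sigma_trunc m K s q + q powr (- s - 2 * of_nat (Suc K) - 1) * c_coeff m (Suc K) s"
    by (simp add: Sigma_trunc_def)
  moreover have "t (Suc (2 * K + 3)) = 0"
    by (simp add: t_def euler_poly_0_even)
  moreover have "(\<Sum>j<2 * Suc K + 3. t j) = (\<Sum>j<2 * K + 3. t j) + t (2 * K + 3) + t (Suc (2 * K + 3))"
    by (simp add: numeral_3_eq_3)
  moreover have "(\<Sum>j<2 * K + 3. t j) = - 1 / 2 * (q powr s * Sigma_trunc m K s q)"
    using Suc.IH by (simp add: t_def)
  ultimately have "(\<Sum>j<2 * Suc K + 3. t j) = - 1 / 2 * (q powr s * Sigma_trunc m (Suc K) s q)"
    unfolding powr[symmetric] by (simp add: distrib_left)
  then show ?case
    by (simp add: t_def)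
qed

text \<open>Multiplied by \<open>q powr s\<close>, the quantity is the \<open>m\<close>-th
  derivative of a polynomial part plus a remainder. The polynomial part yields
  \<open>Sigma_trunc\<close> and terms from \<open>j = 2K + 3\<close> on; Cauchy's inequality
  controls the remainder.\<close>

lemma deriv_plus_log_alt_hurwitz_zeta_bound:
  assumes m: "m \<ge> 2" and c: "0 < c" "c \<le> 1"
  obtains C where "\<And>q. away_from_slit c q \<Longrightarrow> 1 \<le> norm q \<Longrightarrow> 2 \<le> c * norm q \<Longrightarrow>
    norm ((deriv_plus_log q ^^ m) (\<lambda>z. alt_hurwitz_zeta z q) s + 1 / 2 * Sigma_trunc m K s q)
      \<le> C * norm q powr (- Re s - 2 * real K - 3)"
proof -
  \<comment> \<open>The closed unit disc around \<open>s\<close>, used for Cauchy's inequality, has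
    to fit into the ball of radius \<open>S\<close>.\<close>
  define S where "S = norm s + 2"
  \<comment> \<open>Large enough for both \<open>S + 2 \<le> N\<close> and
    \<open>2 - N \<le> - 2K - 3\<close>.\<close>
  define N where "N = 2 * K + 5 + nat \<lceil>S\<rceil>"
  have S: "0 \<le> S" "S + 2 \<le> real N"
    by (auto simp: S_def N_def) linarith
  from boole_expansion[OF c S] obtain D where D: "\<And>q. away_from_slit c q \<Longrightarrow> 1 \<le> norm q \<Longrightarrow> 2 \<le> c * norm q \<Longrightarrow>
    \<exists>R. R holomorphic_on ball 0 S \<and>
      (\<forall>z\<in>ball 0 S. norm (R z) \<le> D * norm q powr (2 - Re z - real N)) \<and>
      (\<forall>z\<in>ball 0 S. Re z > 0 \<longrightarrow> (\<lambda>n. (-1) ^ n / (of_nat n + q) powr z) sums (boole_main N z q + R z))"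
    by blast
  define a :: "nat \<Rightarrow> complex" where "a = (\<lambda>j. (-1) ^ j * euler_poly j 0 / 2)"
  define A where "A = (\<Sum>j=2 * K + 3..<N. norm (a j * nested_sum s m j))"
  define E where "E = fact m * (exp (S * pi) * \<bar>D\<bar>)"
  show ?thesis
  proof
    fix q assume q: "away_from_slit c q" "1 \<le> norm q" "2 \<le> c * norm q"
    have q_nz: "q \<noteq> 0"
      using q by auto
    from D[OF q] obtain R where R: "R holomorphic_on ball 0 S"
      "\<And>z. z \<in> ball 0 S \<Longrightarrow> norm (R z) \<le> D * norm q powr (2 - Re z - real N)"
      "\<And>z. z \<in> ball 0 S \<Longrightarrow> Re z > 0 \<Longrightarrow> (\<lambda>n. (-1) ^ n / (of_nat n + q) powr z) sums (boole_main N z q + R z)"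
      by blast
    define f where "f = (\<lambda>z. alt_hurwitz_zeta z q)"
    define P where "P = (\<lambda>z. \<Sum>j<N. a j / q ^ j * nested_sum z 0 j)"
    define W where "W = (\<lambda>z. q powr z * R z)"
    have f: "f holomorphic_on UNIV"
      unfolding f_def by (rule holomorphic_alt_hurwitz_zeta[OF c q(1)])
    have f_eq: "f z = boole_main N z q + R z" if "z \<in> ball 0 S" for z
    proof (rule holomorphic_eq_on_ball[where f = f and g = "\<lambda>z. boole_main N z q + R z" and r = S])
      show "(\<lambda>z. boole_main N z q + R z) holomorphic_on ball 0 S"
        by (intro holomorphic_intros holomorphic_boole_main R q_nz)
      show "f z = boole_main N z q + R z" if "z \<in> ball 0 S" "Re z > 0" for z
        unfolding f_def using alt_hurwitz_zeta_sums[OF c q(1) that(2)] R(3)[OF that] by (rule sums_unique2)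
    qed (use f that in \<open>auto intro: holomorphic_on_subset\<close>)
    \<comment> \<open>The factor \<open>q powr z\<close> leaves a polynomial in \<open>z\<close>,
      whose derivatives bring in no powers of \<open>Ln q\<close>.\<close>
    have main: "q powr z * boole_main N z q = P z" for z
      using q_nz by (simp add: boole_main_def P_def a_def boole_coeff_def powr_minus mult_ac)
    have P: "P holomorphic_on ball 0 S"
      unfolding P_def by (auto intro!: holomorphic_intros q_nz)
    have W: "W holomorphic_on ball 0 S"
      unfolding W_def using q_nz by (auto intro!: holomorphic_intros R)
    have s: "s \<in> ball 0 S"
      by (simp add: S_def)
    have "q powr s * (deriv_plus_log q ^^ m) f s = (deriv ^^ m) (\<lambda>z. q powr z * f z) s"
      by (simp add: higher_deriv_powr_mult[OF q_nz f])
    also have "\<dots> = (deriv ^^ m) (\<lambda>z. P z + W z) s"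
    proof (rule higher_deriv_transform_within_open[where S = "ball 0 S"])
      show "(\<lambda>z. q powr z * f z) holomorphic_on ball 0 S"
        using q_nz by (auto intro!: holomorphic_intros intro: holomorphic_on_subset[OF f])
      show "(\<lambda>z. P z + W z) holomorphic_on ball 0 S"
        by (intro holomorphic_intros P W)
      show "q powr z * f z = P z + W z" if "z \<in> ball 0 S" for z
        using that by (simp add: f_eq distrib_left main W_def)
    qed (use s in auto)
    also have "\<dots> = (deriv ^^ m) P s + (deriv ^^ m) W s"
      by (rule higher_deriv_add[OF P W _ s]) simp
    also have "(deriv ^^ m) P s = (\<Sum>j<N. a j / q ^ j * nested_sum s m j)"
      unfolding P_def higher_deriv_sum_nested_sum ..
    also have "\<dots> = (\<Sum>j<2 * K + 3. a j / q ^ j * nested_sum s m j) + (\<Sum>j=2 * K + 3..<N. a j / q ^ j * nested_sum s m j)"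
      unfolding lessThan_atLeast0 by (subst sum.atLeastLessThan_concat) (auto simp: N_def)
    also have "(\<Sum>j<2 * K + 3. a j / q ^ j * nested_sum s m j) = - 1 / 2 * (q powr s * Sigma_trunc m K s q)"
      unfolding a_def by (rule boole_coeff_higher_deriv_sum[OF m q_nz])
    finally have eq: "q powr s * ((deriv_plus_log q ^^ m) f s + 1 / 2 * Sigma_trunc m K s q) =
        (\<Sum>j=2 * K + 3..<N. a j / q ^ j * nested_sum s m j) + (deriv ^^ m) W s"
      by (simp add: algebra_simps)
    have 1: "norm (\<Sum>j=2 * K + 3..<N. a j / q ^ j * nested_sum s m j) \<le> A * norm q powr (- 2 * real K - 3)"
      unfolding A_def sum_distrib_right
    proof (rule sum_norm_le)
      fix j assume j: "j \<in> {2 * K + 3..<N}"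
      have "1 / norm q ^ j = norm q powr (- real j)"
        using q_nz by (simp add: powr_minus powr_realpow inverse_eq_divide)
      also have "\<dots> \<le> norm q powr (- 2 * real K - 3)"
        using j q by (intro powr_mono) auto
      finally have "norm (a j * nested_sum s m j) * (1 / norm q ^ j) \<le>
          norm (a j * nested_sum s m j) * norm q powr (- 2 * real K - 3)"
        by (intro mult_left_mono) auto
      then show "norm (a j / q ^ j * nested_sum s m j) \<le> norm (a j * nested_sum s m j) * norm q powr (- 2 * real K - 3)"
        by (simp add: norm_mult norm_divide norm_power)
    qed
    have cball: "cball s 1 \<subseteq> ball 0 S"
    proof
      fix z assume "z \<in> cball s 1"
      then have "norm (z - s) \<le> 1"
        by (simp add: dist_norm norm_minus_commute)
      then show "z \<in> ball 0 S"
        using norm_triangle_sub[of z s] by (simp add: S_def)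
    qed
    have "norm ((deriv ^^ m) W s) \<le> fact m * (exp (S * pi) * \<bar>D\<bar> * norm q powr (- 2 * real K - 3)) / 1 ^ m"
    proof (rule Cauchy_inequality)
      show "W holomorphic_on ball s 1"
        using W by (rule holomorphic_on_subset) (use cball in auto)
      show "continuous_on (cball s 1) W"
        using holomorphic_on_imp_continuous_on[OF W] cball by (rule continuous_on_subset)
      fix z assume z: "norm (s - z) = 1"
      then have "z \<in> cball s 1"
        by (simp add: dist_norm)
      then have z: "z \<in> ball 0 S"
        using cball by blast
      have "D * norm q powr (2 - Re z - real N) \<le> \<bar>D\<bar> * norm q powr (2 - Re z - real N)"
        by (intro mult_right_mono) auto
      with R(2)[OF z] have R_le: "norm (R z) \<le> \<bar>D\<bar> * norm q powr (2 - Re z - real N)"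
        by linarith
      have "norm (q powr z) \<le> norm q powr Re z * exp (\<bar>Im z\<bar> * pi)"
        by (rule norm_powr_complex_le)
      also have "\<dots> \<le> norm q powr Re z * exp (S * pi)"
        using abs_Im_le_cmod[of z] z by (intro mult_left_mono) (auto intro!: mult_right_mono)
      finally have "norm (W z) \<le> norm q powr Re z * exp (S * pi) * (\<bar>D\<bar> * norm q powr (2 - Re z - real N))"
        unfolding W_def norm_mult using R_le by (intro mult_mono) auto
      \<comment> \<open>The powers \<open>norm q powr Re z\<close> cancel exactly, so the bound is
        the same on the whole circle. For this reason Cauchy's inequality is applied to
        \<open>W\<close> and not to \<open>R\<close>.\<close>
      also have "\<dots> = exp (S * pi) * \<bar>D\<bar> * norm q powr (2 - real N)"
        using q_nz by (simp add: powr_diff mult_ac)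
      also have "\<dots> \<le> exp (S * pi) * \<bar>D\<bar> * norm q powr (- 2 * real K - 3)"
        using q by (intro mult_left_mono powr_mono) (auto simp: N_def)
      finally show "norm (W z) \<le> exp (S * pi) * \<bar>D\<bar> * norm q powr (- 2 * real K - 3)" .
    qed simp
    then have "norm ((deriv ^^ m) W s) \<le> E * norm q powr (- 2 * real K - 3)"
      by (simp add: E_def mult_ac)
    with 1 have "norm (q powr s * ((deriv_plus_log q ^^ m) f s + 1 / 2 * Sigma_trunc m K s q)) \<le>
        (A + E) * norm q powr (- 2 * real K - 3)"
      unfolding eq distrib_right by (intro norm_triangle_mono)
    \<comment> \<open>Undo the multiplication by \<open>q powr s\<close>, which supplies the
      remaining \<open>norm q powr (- Re s)\<close>.\<close>
    then have "norm (q powr (- s)) * norm (q powr s * ((deriv_plus_log q ^^ m) f s + 1 / 2 * Sigma_trunc m K s q)) \<le>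
        norm q powr (- Re s) * exp (S * pi) * ((A + E) * norm q powr (- 2 * real K - 3))"
    proof (rule mult_mono[rotated])
      have "exp (\<bar>Im s\<bar> * pi) \<le> exp (S * pi)"
        using abs_Im_le_cmod[of s] by (auto simp: S_def intro!: mult_right_mono)
      then have "norm q powr (- Re s) * exp (\<bar>Im s\<bar> * pi) \<le> norm q powr (- Re s) * exp (S * pi)"
        by (intro mult_left_mono) auto
      then show "norm (q powr (- s)) \<le> norm q powr (- Re s) * exp (S * pi)"
        using norm_powr_complex_le[of q "- s"] by simp
    qed auto
    also have "norm (q powr (- s)) * norm (q powr s * ((deriv_plus_log q ^^ m) f s + 1 / 2 * Sigma_trunc m K s q)) =
        norm ((deriv_plus_log q ^^ m) f s + 1 / 2 * Sigma_trunc m K s q)"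
      using q_nz by (simp add: powr_minus norm_mult norm_inverse)
    also have "norm q powr (- Re s) * exp (S * pi) * ((A + E) * norm q powr (- 2 * real K - 3)) =
        exp (S * pi) * (A + E) * norm q powr (- Re s + (- 2 * real K - 3))"
      unfolding powr_add by (simp add: mult_ac)
    finally show "norm ((deriv_plus_log q ^^ m) (\<lambda>z. alt_hurwitz_zeta z q) s + 1 / 2 * Sigma_trunc m K s q)
      \<le> exp (S * pi) * (A + E) * norm q powr (- Re s - 2 * real K - 3)"
      by (simp add: f_def algebra_simps)
  qed
qed

theorem theorem3p14:
  fixes s :: complex and \<delta> :: real and m :: nat
  assumes "\<delta> > 0" and "m \<ge> 2"
  shows
    "(\<forall>K. (\<lambda>q. (deriv ^^ m) (\<lambda>z. alt_hurwitz_zeta z q) s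
           - (- ((deriv_plus_log q ^^ m) (\<lambda>z. alt_hurwitz_zeta z q) s
                 - (deriv ^^ m) (\<lambda>z. alt_hurwitz_zeta z q) s)
              - 1 / 2 * Sigma_trunc m K s q))
        \<in> O[inf at_infinity (principal (sector \<delta>))](
             \<lambda>q. of_real (norm q powr (- Re s - 2 * real K - 3))))
     \<and> (\<forall>q\<in>sector \<delta>.
          - ((deriv_plus_log q ^^ m) (\<lambda>z. alt_hurwitz_zeta z q) s
             - (deriv ^^ m) (\<lambda>z. alt_hurwitz_zeta z q) s)
          = - (\<Sum>j=1..m. of_nat (m choose j)
                 * (deriv ^^ (m - j)) (\<lambda>z. alt_hurwitz_zeta z q) s * Ln q ^ j))"
proof (intro conjI allI ballI)
  obtain c where c: "0 < c" "c \<le> 1" and sector: "\<And>q. q \<in> sector \<delta> \<Longrightarrow> away_from_slit c q"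
    using sector_away_from_slit[OF assms(1)] by blast
  {
    fix K
    obtain C where C: "\<And>q. away_from_slit c q \<Longrightarrow> 1 \<le> norm q \<Longrightarrow> 2 \<le> c * norm q \<Longrightarrow>
      norm ((deriv_plus_log q ^^ m) (\<lambda>z. alt_hurwitz_zeta z q) s + 1 / 2 * Sigma_trunc m K s q)
        \<le> C * norm q powr (- Re s - 2 * real K - 3)"
      using deriv_plus_log_alt_hurwitz_zeta_bound[OF assms(2) c] by blast
    have "eventually (\<lambda>q :: complex. max 1 (2 / c) \<le> norm q) at_infinity"
      unfolding eventually_at_infinity by blast
    then have "eventually (\<lambda>q. q \<in> sector \<delta> \<longrightarrow>
        norm ((deriv_plus_log q ^^ m) (\<lambda>z. alt_hurwitz_zeta z q) s + 1 / 2 * Sigma_trunc m K s q)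
          \<le> C * norm q powr (- Re s - 2 * real K - 3)) at_infinity"
    proof eventually_elim
      case (elim q)
      then have "1 \<le> norm q" "2 / c \<le> norm q"
        by simp_all
      then have "1 \<le> norm q" "2 \<le> c * norm q"
        using c by (simp_all add: pos_divide_le_eq mult.commute)
      then show ?case
        using C[OF sector] by blast
    qed
    then show "(\<lambda>q. (deriv ^^ m) (\<lambda>z. alt_hurwitz_zeta z q) s
           - (- ((deriv_plus_log q ^^ m) (\<lambda>z. alt_hurwitz_zeta z q) s
                 - (deriv ^^ m) (\<lambda>z. alt_hurwitz_zeta z q) s)
              - 1 / 2 * Sigma_trunc m K s q))
        \<in> O[inf at_infinity (principal (sector \<delta>))](
             \<lambda>q. of_real (norm q powr (- Re s - 2 * real K - 3)))"
      \<comment> \<open>The two copies of the \<open>m\<close>-th derivative cancel, and the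
        difference is exactly the quantity bounded by \<open>C\<close>.\<close>
      by (intro bigoI[where c = C]) (simp add: eventually_inf_principal)
  }
  fix q assume q: "q \<in> sector \<delta>"
  then have "q \<noteq> 0"
    by (simp add: sector_def)
  then have "(deriv_plus_log q ^^ m) (\<lambda>z. alt_hurwitz_zeta z q) s =
      (\<Sum>j=0..m. of_nat (m choose j) * (deriv ^^ (m - j)) (\<lambda>z. alt_hurwitz_zeta z q) s * Ln q ^ j)"
    by (rule deriv_plus_log_binomial[OF _ holomorphic_alt_hurwitz_zeta[OF c sector[OF q]]])
  then show "- ((deriv_plus_log q ^^ m) (\<lambda>z. alt_hurwitz_zeta z q) s
             - (deriv ^^ m) (\<lambda>z. alt_hurwitz_zeta z q) s)
          = - (\<Sum>j=1..m. of_nat (m choose j)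
                 * (deriv ^^ (m - j)) (\<lambda>z. alt_hurwitz_zeta z q) s * Ln q ^ j)"
    \<comment> \<open>The subtracted derivative is the term \<open>j = 0\<close> of the binomial
      sum.\<close>
    by (simp add: sum.atLeast_Suc_atMost)
qed

end
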